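(* There exists a finite, atomistic, join-semidistributive lattice $L$ that cannot be embedded (by an injective map preserving binary joins and binary meets) into any finite, or even nœtherian, atomistic, biatomic, join-semidistributive lattice.
   Context: A partially ordered set is nœtherian if it has no infinite strictly increasing chain. A lattice $M$ with least element $0$ is atomic if every nonzero element lies above an atom; atomistic if every element is a join of atoms ($0$ being the empty join); biatomic if it is atomic and for every atom $p$ and all nonzero $a,b\in M$ with $p\le a\vee b$, there are atoms $x\le a$ and $y\le b$ of $M$ with $p\le x\vee y$. A lattice is join-semidistributive if $x\vee y=x\vee z$ implies $x\vee y=x\vee(y\wedge z)$, for all $x,y,z$. *)

theory Defs
  imports "HOL-Algebra.Lattice"
begin

text \<open>
  Lattices are records of type \<open>'a gorder\<close> satisfying the locale \<^locale>\<open>lattice\<close>, in which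
  the equivalence of the record is equality.  The predicates below are meant for such records,
  those that mention \<open>\<bottom>\<^bsub>M\<^esub>\<close> for ones that also satisfy
  \<^locale>\<open>weak_partial_order_bottom\<close>: otherwise \<open>\<bottom>\<^bsub>M\<^esub>\<close> is unspecified.
\<close>

definition noetherian :: "('a, 'm) gorder_scheme \<Rightarrow> bool" where
  "noetherian M \<longleftrightarrow>
     \<not> (\<exists>x :: nat \<Rightarrow> 'a. \<forall>n. x n \<in> carrier M \<and> x n \<sqsubset>\<^bsub>M\<^esub> x (Suc n))"

definition is_atom :: "('a, 'm) gorder_scheme \<Rightarrow> 'a \<Rightarrow> bool" where
  "is_atom M p \<longleftrightarrow>
     p \<in> carrier M \<and> p \<noteq> \<bottom>\<^bsub>M\<^esub> \<and>
     (\<forall>x \<in> carrier M. x \<sqsubseteq>\<^bsub>M\<^esub> p \<longrightarrow> x = \<bottom>\<^bsub>M\<^esub> \<or> x = p)"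

definition atomic :: "('a, 'm) gorder_scheme \<Rightarrow> bool" where
  "atomic M \<longleftrightarrow>
     (\<forall>a \<in> carrier M. a \<noteq> \<bottom>\<^bsub>M\<^esub> \<longrightarrow> (\<exists>p. is_atom M p \<and> p \<sqsubseteq>\<^bsub>M\<^esub> a))"

text \<open>
  The set of atoms may be infinite; for the empty set the join is \<open>\<bottom>\<^bsub>M\<^esub>\<close>.
\<close>

definition atomistic :: "('a, 'm) gorder_scheme \<Rightarrow> bool" where
  "atomistic M \<longleftrightarrow>
     (\<forall>a \<in> carrier M. \<exists>P. P \<subseteq> {p. is_atom M p} \<and> least M a (Upper M P))"

definition biatomic :: "('a, 'm) gorder_scheme \<Rightarrow> bool" where
  "biatomic M \<longleftrightarrow>
     atomic M \<and>
     (\<forall>p. \<forall>a \<in> carrier M. \<forall>b \<in> carrier M.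
        is_atom M p \<and> a \<noteq> \<bottom>\<^bsub>M\<^esub> \<and> b \<noteq> \<bottom>\<^bsub>M\<^esub> \<and> p \<sqsubseteq>\<^bsub>M\<^esub> a \<squnion>\<^bsub>M\<^esub> b \<longrightarrow>
        (\<exists>x y. is_atom M x \<and> is_atom M y \<and> x \<sqsubseteq>\<^bsub>M\<^esub> a \<and> y \<sqsubseteq>\<^bsub>M\<^esub> b \<and> p \<sqsubseteq>\<^bsub>M\<^esub> x \<squnion>\<^bsub>M\<^esub> y))"

definition join_semidistributive :: "('a, 'm) gorder_scheme \<Rightarrow> bool" where
  "join_semidistributive M \<longleftrightarrow>
     (\<forall>x \<in> carrier M. \<forall>y \<in> carrier M. \<forall>z \<in> carrier M.
        x \<squnion>\<^bsub>M\<^esub> y = x \<squnion>\<^bsub>M\<^esub> z \<longrightarrow> x \<squnion>\<^bsub>M\<^esub> y = x \<squnion>\<^bsub>M\<^esub> (y \<sqinter>\<^bsub>M\<^esub> z))"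

definition lattice_embedding ::
  "('a, 'm) gorder_scheme \<Rightarrow> ('b, 'n) gorder_scheme \<Rightarrow> ('a \<Rightarrow> 'b) \<Rightarrow> bool" where
  "lattice_embedding L M f \<longleftrightarrow>
     f \<in> carrier L \<rightarrow> carrier M \<and> inj_on f (carrier L) \<and> join_pres L M f \<and> meet_pres L M f"

text \<open>
  HOL cannot quantify over the type of the lattice \<open>M\<close> inside an existential statement: in
  \<open>\<exists>L. \<dots> (\<forall>M :: 'b gorder. \<dots>)\<close> the lattice \<open>L\<close> could depend on the type \<open>'b\<close>.  The single
  lattice that works for all types is therefore given by name.

  It is the lattice of relatively convex subsets of five points in the plane, for instance
  \<open>a = (0, 0)\<close>, \<open>b = (8, 0)\<close>, \<open>c = (0, 8)\<close>, \<open>p = (2, 2)\<close> and \<open>r = (1, 5)\<close>: the points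
  \<open>a\<close>, \<open>b\<close>, \<open>c\<close> span a triangle with \<open>p\<close> and \<open>r\<close> in its interior, \<open>r\<close> is the midpoint of
  the segment from \<open>c\<close> to \<open>p\<close>, and \<open>p\<close> lies inside the triangle spanned by \<open>a\<close>, \<open>b\<close>, \<open>r\<close>.
\<close>

datatype point = pt_a | pt_b | pt_c | pt_p | pt_r

definition rel_convex :: "point set \<Rightarrow> bool" where
  "rel_convex X \<longleftrightarrow>
     ({pt_c, pt_p} \<subseteq> X \<longrightarrow> pt_r \<in> X) \<and>
     ({pt_a, pt_b, pt_r} \<subseteq> X \<longrightarrow> pt_p \<in> X) \<and>
     ({pt_a, pt_b, pt_c} \<subseteq> X \<longrightarrow> {pt_p, pt_r} \<subseteq> X)"

definition five_point_lattice :: "point set gorder" where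
  "five_point_lattice = \<lparr> carrier = {X. rel_convex X}, eq = (=), le = (\<subseteq>) \<rparr>"

end

theory Submission
  imports Defs
begin

text \<open>
  Let \<open>f\<close> embed the five-point lattice into a lattice \<open>M\<close> of the forbidden kind.  Write \<open>A\<close>, \<open>B\<close>,
  \<open>C\<close> for the images of the corners \<open>{a}\<close>, \<open>{b}\<close>, \<open>{c}\<close>, and \<open>U\<close>, \<open>V\<close>, \<open>W\<close> for those of
  \<open>{b, p}\<close>, \<open>{b, r}\<close>, \<open>{a, c}\<close>.  The two convexity relations on the five points give
  \<open>U \<sqsubseteq> A \<squnion> V\<close> and \<open>V \<sqsubseteq> C \<squnion> U\<close>.

  In the plane, a point \<open>q\<close> of the segment \<open>bp\<close> can be moved as follows: the ray from \<open>a\<close> through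
  \<open>q\<close> meets the segment \<open>br\<close> in a point \<open>x\<close> beyond \<open>q\<close>, and the ray from \<open>c\<close> through \<open>x\<close> meets
  \<open>bp\<close> in a point \<open>q'\<close> beyond \<open>x\<close>.  Repetition yields an infinite zigzag between the two segments,
  which converges to \<open>b\<close> and recedes from the line \<open>ac\<close> at every step.  Biatomicity makes the same
  moves available to the atoms of \<open>M\<close> (lemma \<open>biatomic_choose_second\<close>): for an atom \<open>q \<sqsubseteq> U\<close> there
  is an atom \<open>x \<sqsubseteq> V\<close> with \<open>q \<sqsubseteq> A \<squnion> x\<close>, and then an atom \<open>q' \<sqsubseteq> U\<close> with \<open>x \<sqsubseteq> C \<squnion> q'\<close>.  Since
  \<open>A\<close> and \<open>C\<close> lie below \<open>W\<close>, this gives \<open>W \<squnion> q \<sqsubseteq> W \<squnion> x \<sqsubseteq> W \<squnion> q'\<close>.  If \<open>W \<squnion> q = W \<squnion> x\<close>, then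
  join-semidistributivity forces \<open>q = x\<close> (lemma \<open>join_semidistributive_atom_exchange\<close>), and this
  atom lies below \<open>U \<sqinter> V = B\<close>.  The meets \<open>U \<sqinter> (A \<squnion> B) = B\<close> and \<open>V \<sqinter> (C \<squnion> B) = B\<close> show that a
  zigzag that starts outside \<open>B\<close> never enters \<open>B\<close>.  So the elements \<open>W \<squnion> q\<close> increase strictly
  forever, which a noetherian lattice does not allow (lemma \<open>biatomic_zigzag\<close>).  To start the
  zigzag, take an atom below \<open>f {p}\<close> but not below \<open>f {}\<close>; it lies below neither \<open>B\<close> nor \<open>W\<close>,
  because \<open>f\<close> preserves meets.

  The five-point lattice itself is join-semidistributive because it is a convex geometry: a
  relatively convex set that strictly contains another one can lose one of the additional points
  and stay relatively convex (lemma \<open>rel_convex_remove_point\<close>).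
\<close>

section \<open>Atoms of biatomic, join-semidistributive lattices\<close>

lemma (in lattice) join_mono:
  assumes "x \<sqsubseteq> x'" "y \<sqsubseteq> y'"
    and "x \<in> carrier L" "x' \<in> carrier L" "y \<in> carrier L" "y' \<in> carrier L"
  shows "x \<squnion> y \<sqsubseteq> x' \<squnion> y'"
proof (rule join_le)
  show "x \<sqsubseteq> x' \<squnion> y'"
    by (rule le_trans[OF assms(1) join_left]) (use assms in auto)
  show "y \<sqsubseteq> x' \<squnion> y'"
    by (rule le_trans[OF assms(2) join_right]) (use assms in auto)
qed (use assms in auto)

text \<open>
  Two distinct atoms meet in \<open>\<bottom>\<close>, so join-semidistributivity makes a common join with \<open>w\<close> collapse
  to \<open>w\<close>.
\<close>

lemma join_semidistributive_atom_exchange: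
  fixes M (structure)
  assumes "lattice M" "weak_partial_order_bottom M" "join_semidistributive M"
    and p: "is_atom M p" and x: "is_atom M x" and w: "w \<in> carrier M"
    and eq: "w \<squnion> p = w \<squnion> x" and np: "\<not> p \<sqsubseteq> w"
  shows "p = x"
proof (rule ccontr)
  assume "p \<noteq> x"
  interpret lattice M by fact
  interpret weak_partial_order_bottom M by fact
  have pM: "p \<in> carrier M" and xM: "x \<in> carrier M"
    using p x by (auto simp: is_atom_def)
  have "p \<sqinter> x = \<bottom>"
  proof (rule ccontr)
    assume "p \<sqinter> x \<noteq> \<bottom>"
    then have "p \<sqinter> x = p" "p \<sqinter> x = x"
      using p x meet_left[OF pM xM] meet_right[OF pM xM] pM xM meet_closed[OF pM xM]
      unfolding is_atom_def by blast+
    with \<open>p \<noteq> x\<close> show False by simp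
  qed
  moreover have "w \<squnion> p = w \<squnion> (p \<sqinter> x)"
    using assms(3) w pM xM eq unfolding join_semidistributive_def by blast
  moreover have "w \<squnion> \<bottom> \<sqsubseteq> w"
    using w by (intro join_le) auto
  ultimately have "p \<sqsubseteq> w"
    using join_right[OF w pM] le_trans w pM by (metis bottom_closed join_closed)
  with np show False ..
qed

text \<open>
  The atom below \<open>a\<close> that biatomicity provides is absorbed into \<open>a\<close>: the zigzag needs only the atom
  on the other side.  Biatomicity speaks of nonzero elements only, but \<open>v = \<bottom>\<close> would put \<open>p\<close> below \<open>a\<close>,
  and for \<open>a = \<bottom>\<close> the atom \<open>p\<close> itself lies below \<open>v\<close>.
\<close>

lemma biatomic_choose_second:
  fixes M (structure)
  assumes "lattice M" "weak_partial_order_bottom M" "biatomic M"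
    and p: "is_atom M p" and a: "a \<in> carrier M" and v: "v \<in> carrier M"
    and le: "p \<sqsubseteq> a \<squnion> v" and np: "\<not> p \<sqsubseteq> a"
  obtains x where "is_atom M x" "x \<sqsubseteq> v" "p \<sqsubseteq> a \<squnion> x"
proof -
  interpret lattice M by fact
  interpret weak_partial_order_bottom M by fact
  have pM: "p \<in> carrier M" using p by (auto simp: is_atom_def)
  show thesis
  proof (cases "a = \<bottom>")
    case True
    have "a \<squnion> v \<sqsubseteq> v" using True v by (intro join_le) auto
    with le have "p \<sqsubseteq> v" using le_trans pM a v by (metis join_closed)
    then show thesis using that[OF p] join_right[OF a pM] by blast
  next
    case False
    have "v \<noteq> \<bottom>"
    proof
      assume "v = \<bottom>"
      then have "a \<squnion> v \<sqsubseteq> a" using a by (intro join_le) auto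
      with le np show False using le_trans pM a v by (metis join_closed)
    qed
    with False assms(3) p a v le obtain y x where
      y: "is_atom M y" "y \<sqsubseteq> a" and x: "is_atom M x" "x \<sqsubseteq> v" and "p \<sqsubseteq> y \<squnion> x"
      unfolding biatomic_def by blast
    have yM: "y \<in> carrier M" and xM: "x \<in> carrier M"
      using x y by (auto simp: is_atom_def)
    have "y \<squnion> x \<sqsubseteq> a \<squnion> x"
      by (rule join_mono) (use y(2) yM xM a in auto)
    then have "p \<sqsubseteq> a \<squnion> x"
      using le_trans[OF \<open>p \<sqsubseteq> y \<squnion> x\<close>] pM a yM xM by simp
    with x that show thesis by blast
  qed
qed

lemma noetherian_no_climb:
  assumes "partial_order M" "noetherian M"
    and closed: "\<And>p. Q p \<Longrightarrow> g p \<in> carrier M"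
    and climb: "\<And>p. Q p \<Longrightarrow> \<exists>q. Q q \<and> g p \<sqsubseteq>\<^bsub>M\<^esub> g q \<and> g p \<noteq> g q"
  shows "\<not> Q p"
proof
  assume "Q p"
  interpret partial_order M by fact
  obtain s where s: "\<And>n. Q (s n)"
      "\<And>n. g (s n) \<sqsubseteq>\<^bsub>M\<^esub> g (s (Suc n)) \<and> g (s n) \<noteq> g (s (Suc n))"
    using dependent_nat_choice
      [of "\<lambda>_. Q" "\<lambda>_ p q. g p \<sqsubseteq>\<^bsub>M\<^esub> g q \<and> g p \<noteq> g q"] \<open>Q p\<close> climb by blast
  then have "\<forall>n. g (s n) \<in> carrier M \<and> g (s n) \<sqsubset>\<^bsub>M\<^esub> g (s (Suc n))"
    using closed by (auto simp: lless_def eq_is_equal)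
  then have "\<exists>y. \<forall>n. y n \<in> carrier M \<and> y n \<sqsubset>\<^bsub>M\<^esub> y (Suc n)"
    by (intro exI[of _ "\<lambda>n. g (s n)"])
  with assms(2) show False unfolding noetherian_def by blast
qed

text \<open>
  The zigzag needs only a few inequalities between six elements, not the whole embedded lattice.
  The inequalities are symmetric under exchanging \<open>a, u\<close> with \<open>c, v\<close>, so the two halves of a
  zigzag step are two instances of one fact.
\<close>

lemma biatomic_zigzag:
  fixes M (structure)
  assumes M: "lattice M" "weak_partial_order_bottom M" "noetherian M" "biatomic M"
      "join_semidistributive M"
    and carr: "a \<in> carrier M" "b \<in> carrier M" "c \<in> carrier M"
      "u \<in> carrier M" "v \<in> carrier M" "w \<in> carrier M"
    and aw: "a \<sqsubseteq> w" and cw: "c \<sqsubseteq> w"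
    and uv: "u \<sqsubseteq> a \<squnion> v" and vu: "v \<sqsubseteq> c \<squnion> u"
    and u_ab: "u \<sqinter> (a \<squnion> b) \<sqsubseteq> b" and v_cb: "v \<sqinter> (c \<squnion> b) \<sqsubseteq> b" and uv_b: "u \<sqinter> v \<sqsubseteq> b"
    and p: "is_atom M p" "p \<sqsubseteq> u"
  shows "p \<sqsubseteq> b \<or> p \<sqsubseteq> w"
proof -
  interpret lattice M by fact
  interpret weak_partial_order_bottom M by fact
  define Q where "Q q \<longleftrightarrow> is_atom M q \<and> q \<sqsubseteq> u \<and> \<not> q \<sqsubseteq> b \<and> \<not> q \<sqsubseteq> w" for q
  have atom_closed: "q \<in> carrier M" if "is_atom M q" for q
    using that by (simp add: is_atom_def)
  \<comment> \<open>Half a zigzag step, from \<open>t\<close> to \<open>t'\<close>; used with \<open>d, t, t' = a, u, v\<close> and \<open>d, t, t' = c, v, u\<close>.\<close>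
  have step: "\<exists>x. is_atom M x \<and> x \<sqsubseteq> t' \<and> \<not> x \<sqsubseteq> b \<and> \<not> x \<sqsubseteq> w \<and> w \<squnion> q \<sqsubseteq> w \<squnion> x"
    if d: "d \<in> carrier M" "d \<sqsubseteq> w" and t: "t \<in> carrier M" "t' \<in> carrier M"
      and tt': "t \<sqsubseteq> d \<squnion> t'" and meet: "t \<sqinter> (d \<squnion> b) \<sqsubseteq> b"
      and q: "is_atom M q" "q \<sqsubseteq> t" "\<not> q \<sqsubseteq> b" "\<not> q \<sqsubseteq> w" for d t t' q
  proof -
    have qM: "q \<in> carrier M" using atom_closed q by blast
    have "q \<sqsubseteq> d \<squnion> t'" using le_trans[OF q(2) tt'] qM t d by simp
    moreover have "\<not> q \<sqsubseteq> d" using q(4) le_trans[of q d w] d qM carr by blast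
    ultimately obtain x where x: "is_atom M x" "x \<sqsubseteq> t'" "q \<sqsubseteq> d \<squnion> x"
      using biatomic_choose_second[OF M(1,2,4) q(1) d(1) t(2)] by blast
    have xM: "x \<in> carrier M" using atom_closed x by blast
    have "\<not> x \<sqsubseteq> b"
    proof
      assume "x \<sqsubseteq> b"
      then have "d \<squnion> x \<sqsubseteq> d \<squnion> b"
        by (intro join_mono) (use d xM carr in auto)
      then have "q \<sqsubseteq> d \<squnion> b" using x(3) le_trans[of q "d \<squnion> x" "d \<squnion> b"] qM d xM carr by simp
      then have "q \<sqsubseteq> t \<sqinter> (d \<squnion> b)" using q(2) qM t d carr by (intro meet_le) auto
      then have "q \<sqsubseteq> b" using meet le_trans[of q "t \<sqinter> (d \<squnion> b)" b] qM t d carr by simp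
      with q(3) show False ..
    qed
    moreover have q_wx: "q \<sqsubseteq> w \<squnion> x"
    proof -
      have "d \<squnion> x \<sqsubseteq> w \<squnion> x"
        by (intro join_mono) (use d xM carr in auto)
      then show ?thesis using x(3) le_trans[of q "d \<squnion> x" "w \<squnion> x"] qM d xM carr by simp
    qed
    moreover have "\<not> x \<sqsubseteq> w"
    proof
      assume "x \<sqsubseteq> w"
      then have "w \<squnion> x \<sqsubseteq> w" using carr xM by (intro join_le) auto
      then have "q \<sqsubseteq> w" using q_wx le_trans[of q "w \<squnion> x" w] qM xM carr by simp
      with q(4) show False ..
    qed
    moreover have "w \<squnion> q \<sqsubseteq> w \<squnion> x"
      using q_wx carr xM qM join_left[of w x] by (intro join_le) auto
    ultimately show ?thesis using x by blast
  qed
  have "\<exists>q'. Q q' \<and> w \<squnion> q \<sqsubseteq> w \<squnion> q' \<and> w \<squnion> q \<noteq> w \<squnion> q'" if "Q q" for q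
  proof -
    have q: "is_atom M q" "q \<sqsubseteq> u" "\<not> q \<sqsubseteq> b" "\<not> q \<sqsubseteq> w" using that by (auto simp: Q_def)
    obtain x where x: "is_atom M x" "x \<sqsubseteq> v" "\<not> x \<sqsubseteq> b" "\<not> x \<sqsubseteq> w" "w \<squnion> q \<sqsubseteq> w \<squnion> x"
      using step[OF carr(1) aw carr(4,5) uv u_ab q] by blast
    obtain q' where q': "is_atom M q'" "q' \<sqsubseteq> u" "\<not> q' \<sqsubseteq> b" "\<not> q' \<sqsubseteq> w"
        "w \<squnion> x \<sqsubseteq> w \<squnion> q'"
      using step[OF carr(3) cw carr(5,4) vu v_cb x(1-4)] by blast
    have cl: "q \<in> carrier M" "x \<in> carrier M" "q' \<in> carrier M"
      using q x q' atom_closed by auto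
    have "w \<squnion> q \<noteq> w \<squnion> x"
    proof
      assume "w \<squnion> q = w \<squnion> x"
      then have "q = x"
        using join_semidistributive_atom_exchange[OF M(1,2,5) q(1) x(1) carr(6)] q(4) by blast
      then have "q \<sqsubseteq> u \<sqinter> v" using q(2) x(2) cl carr by (intro meet_le) auto
      then have "q \<sqsubseteq> b" using uv_b le_trans[of q "u \<sqinter> v" b] cl carr by simp
      with q(3) show False ..
    qed
    then have "w \<squnion> q \<noteq> w \<squnion> q'"
      using x(5) q'(5) le_antisym[of "w \<squnion> q" "w \<squnion> x"] cl carr by auto
    moreover have "w \<squnion> q \<sqsubseteq> w \<squnion> q'"
      using le_trans[OF x(5) q'(5)] cl carr by simp
    ultimately show ?thesis using q' by (auto simp: Q_def)
  qed
  moreover have "w \<squnion> q \<in> carrier M" if "Q q" for q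
    using that carr atom_closed by (auto simp: Q_def)
  ultimately have "\<not> Q p"
    using noetherian_no_climb[of M Q "\<lambda>q. w \<squnion> q"] M(3) partial_order_axioms by blast
  with p show ?thesis by (auto simp: Q_def)
qed

lemma atomistic_atom_not_below:
  assumes "lattice M" "atomistic M"
    and x: "x \<in> carrier M" and y: "y \<in> carrier M" and "\<not> x \<sqsubseteq>\<^bsub>M\<^esub> y"
  obtains p where "is_atom M p" "p \<sqsubseteq>\<^bsub>M\<^esub> x" "\<not> p \<sqsubseteq>\<^bsub>M\<^esub> y"
proof -
  interpret lattice M by fact
  obtain P where P: "P \<subseteq> {p. is_atom M p}" "least M x (Upper M P)"
    using assms(2) x unfolding atomistic_def by blast
  have PM: "P \<subseteq> carrier M" using P(1) by (auto simp: is_atom_def)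
  have "y \<notin> Upper M P" using P(2) assms(5) least_le by metis
  then obtain p where "p \<in> P" "\<not> p \<sqsubseteq>\<^bsub>M\<^esub> y"
    using y PM by (auto simp: Upper_def)
  moreover have "p \<sqsubseteq>\<^bsub>M\<^esub> x" using least_Upper_above[OF P(2) \<open>p \<in> P\<close> PM] .
  ultimately show thesis using that P(1) by auto
qed

section \<open>The lattice of relatively convex sets\<close>

lemma five_point_simps [simp]:
  "carrier five_point_lattice = {X. rel_convex X}"
  "le five_point_lattice = (\<subseteq>)"
  "eq five_point_lattice = (=)"
  by (simp_all add: five_point_lattice_def)

lemma finite_points: "finite (A :: point set)"
proof (rule finite_subset)
  show "A \<subseteq> {pt_a, pt_b, pt_c, pt_p, pt_r}" using point.exhaust by blast
qed simp

lemma rel_convex_Int: "rel_convex X \<Longrightarrow> rel_convex Y \<Longrightarrow> rel_convex (X \<inter> Y)"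
  by (auto simp: rel_convex_def)

lemma rel_convex_Inter: "(\<And>X. X \<in> \<X> \<Longrightarrow> rel_convex X) \<Longrightarrow> rel_convex (\<Inter>\<X>)"
  unfolding rel_convex_def by blast

lemma rel_convex_singleton: "rel_convex {x}"
  by (cases x) (auto simp: rel_convex_def)

lemma lattice_five_point: "lattice five_point_lattice"
proof -
  interpret partial_order five_point_lattice
    by unfold_locales auto
  show ?thesis
  proof unfold_locales
    fix X Y
    assume XY: "X \<in> carrier five_point_lattice" "Y \<in> carrier five_point_lattice"
    have "least five_point_lattice (\<Inter>{Z. rel_convex Z \<and> X \<subseteq> Z \<and> Y \<subseteq> Z})
        (Upper five_point_lattice {X, Y})"
      using XY by (auto simp: least_def Upper_def intro!: rel_convex_Inter)
    then show "\<exists>S. least five_point_lattice S (Upper five_point_lattice {X, Y})" ..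
    have "greatest five_point_lattice (X \<inter> Y) (Lower five_point_lattice {X, Y})"
      using XY by (auto simp: greatest_def Lower_def intro!: rel_convex_Int)
    then show "\<exists>S. greatest five_point_lattice S (Lower five_point_lattice {X, Y})" ..
  qed
qed

interpretation five_point: lattice five_point_lattice
  by (rule lattice_five_point)

lemma five_point_meet:
  assumes "rel_convex X" "rel_convex Y"
  shows "X \<sqinter>\<^bsub>five_point_lattice\<^esub> Y = X \<inter> Y"
proof
  show "X \<sqinter>\<^bsub>five_point_lattice\<^esub> Y \<subseteq> X \<inter> Y"
    using five_point.meet_left[of X Y] five_point.meet_right[of X Y] assms by auto
  show "X \<inter> Y \<subseteq> X \<sqinter>\<^bsub>five_point_lattice\<^esub> Y"
    using five_point.meet_le[of "X \<inter> Y" X Y] assms rel_convex_Int by auto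
qed

lemma five_point_join_le:
  assumes "rel_convex X" "rel_convex Y" "rel_convex Z" "X \<subseteq> Z" "Y \<subseteq> Z"
  shows "X \<squnion>\<^bsub>five_point_lattice\<^esub> Y \<subseteq> Z"
  using five_point.join_le[of X Z Y] assms by simp

lemma five_point_bottom: "\<bottom>\<^bsub>five_point_lattice\<^esub> = {}"
proof -
  have empty: "rel_convex {}" by (simp add: rel_convex_def)
  then have "least five_point_lattice {} (carrier five_point_lattice)"
    by (simp add: least_def)
  then have "least five_point_lattice \<bottom>\<^bsub>five_point_lattice\<^esub> (carrier five_point_lattice)"
    unfolding bottom_def by (rule someI)
  with empty show ?thesis by (auto simp: least_def)
qed

lemma atomistic_five_point: "atomistic five_point_lattice"
  unfolding atomistic_def
proof
  fix X assume X: "X \<in> carrier five_point_lattice"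
  have "is_atom five_point_lattice {x}" for x
    by (auto simp: is_atom_def five_point_bottom rel_convex_singleton)
  moreover have "least five_point_lattice X (Upper five_point_lattice ((\<lambda>x. {x}) ` X))"
    unfolding least_def
  proof (intro conjI ballI)
    show "Upper five_point_lattice ((\<lambda>x. {x}) ` X) \<subseteq> carrier five_point_lattice"
      by (rule Upper_closed)
    show "X \<in> Upper five_point_lattice ((\<lambda>x. {x}) ` X)"
      using X by (intro Upper_memI) auto
    fix Z assume Z: "Z \<in> Upper five_point_lattice ((\<lambda>x. {x}) ` X)"
    have "x \<in> Z" if "x \<in> X" for x
      using Upper_memD[OF Z imageI[OF that]] rel_convex_singleton by auto
    then show "X \<sqsubseteq>\<^bsub>five_point_lattice\<^esub> Z" by auto
  qed
  ultimately show "\<exists>P\<subseteq>{P. is_atom five_point_lattice P}.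
      least five_point_lattice X (Upper five_point_lattice P)"
    by (intro exI[of _ "(\<lambda>x. {x}) ` X"]) auto
qed

text \<open>
  No relation forces a corner into a set, so an additional corner can always be removed.  If there
  is none, then \<open>W\<close> exceeds \<open>K\<close> by \<open>p\<close> or \<open>r\<close> only.  Removing \<open>p\<close> fails when \<open>a\<close>, \<open>b\<close>, \<open>r\<close> all
  belong to \<open>W\<close>; then \<open>r\<close> is an additional point as soon as \<open>p\<close> is, since \<open>K\<close> contains \<open>a\<close> and \<open>b\<close>,
  and \<open>r\<close> can be removed instead.  Removing \<open>r\<close> could fail only if \<open>c\<close> and \<open>p\<close> belong to \<open>W\<close>.  Then
  \<open>c \<in> K\<close>, so \<open>p \<in> K\<close> would put \<open>r\<close> into \<open>K\<close>; and if \<open>p\<close> is an additional point that cannot be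
  removed, then \<open>K\<close> contains all three corners and with them \<open>p\<close>.
\<close>

lemma rel_convex_remove_point:
  assumes "rel_convex K" "rel_convex W" "K \<subset> W"
  shows "\<exists>e \<in> W - K. rel_convex (W - {e})"
proof (cases "{pt_a, pt_b, pt_c} \<inter> (W - K) = {}")
  case False
  then obtain e where e: "e \<in> W - K" "e \<in> {pt_a, pt_b, pt_c}" by blast
  then have "rel_convex (W - {e})"
    using assms(2) by (auto simp: rel_convex_def)
  with e show ?thesis by blast
next
  case True
  show ?thesis
  proof (cases "pt_p \<in> W - K \<and> \<not> {pt_a, pt_b, pt_r} \<subseteq> W")
    case p: True
    then have "rel_convex (W - {pt_p})"
      using assms True unfolding rel_convex_def by auto
    with p show ?thesis by blast
  next
    case p: False
    obtain e where e: "e \<in> W - K" using assms(3) by blast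
    then have "pt_r \<in> W - K"
      using True p assms(1,2) unfolding rel_convex_def by (cases e) auto
    moreover have "rel_convex (W - {pt_r})"
      using \<open>pt_r \<in> W - K\<close> assms True p unfolding rel_convex_def by auto
    ultimately show ?thesis by blast
  qed
qed

text \<open>
  If \<open>X \<squnion> (Y \<inter> Z)\<close> were smaller than \<open>W = X \<squnion> Y = X \<squnion> Z\<close>, it would avoid a point \<open>e\<close> whose removal
  from \<open>W\<close> leaves a relatively convex set.  This set contains \<open>X\<close>, so it contains neither \<open>Y\<close> nor
  \<open>Z\<close>; hence \<open>e \<in> Y \<inter> Z\<close>, a contradiction.
\<close>

lemma join_semidistributive_five_point: "join_semidistributive five_point_lattice"
  unfolding join_semidistributive_def
proof (intro ballI impI)
  let ?L = five_point_lattice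
  fix X Y Z
  assume cl: "X \<in> carrier ?L" "Y \<in> carrier ?L" "Z \<in> carrier ?L"
    and eq: "X \<squnion>\<^bsub>?L\<^esub> Y = X \<squnion>\<^bsub>?L\<^esub> Z"
  define W K where "W = X \<squnion>\<^bsub>?L\<^esub> Y" and "K = X \<squnion>\<^bsub>?L\<^esub> (Y \<inter> Z)"
  have YZ: "Y \<inter> Z \<in> carrier ?L" using cl rel_convex_Int by simp
  have W: "rel_convex W" "X \<subseteq> W" "Y \<subseteq> W" "Z \<subseteq> W"
    using five_point.join_closed[OF cl(1,2)] five_point.join_left[OF cl(1,2)]
      five_point.join_right[OF cl(1,2)] five_point.join_right[OF cl(1,3)] eq
    by (simp_all add: W_def)
  have K: "rel_convex K" "X \<subseteq> K" "Y \<inter> Z \<subseteq> K"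
    using five_point.join_closed[OF cl(1) YZ] five_point.join_left[OF cl(1) YZ]
      five_point.join_right[OF cl(1) YZ]
    by (simp_all add: K_def)
  have "K \<subseteq> W"
    unfolding K_def by (rule five_point_join_le) (use cl YZ W in auto)
  have "K = W"
  proof (rule ccontr)
    assume "K \<noteq> W"
    with \<open>K \<subseteq> W\<close> obtain e where e: "e \<in> W - K" "rel_convex (W - {e})"
      using rel_convex_remove_point[OF K(1) W(1)] by blast
    have "e \<in> T" if T: "T \<in> carrier ?L" "T \<subseteq> W" "X \<squnion>\<^bsub>?L\<^esub> T = W" for T
    proof (rule ccontr)
      assume "e \<notin> T"
      then have "X \<squnion>\<^bsub>?L\<^esub> T \<subseteq> W - {e}"
        by (intro five_point_join_le) (use cl(1) T(1,2) K(2) W(2) e in auto)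
      with T(3) e show False by blast
    qed
    then have "e \<in> Y \<inter> Z" using cl W eq by (simp add: W_def)
    with K(3) e show False by blast
  qed
  then show "X \<squnion>\<^bsub>?L\<^esub> Y = X \<squnion>\<^bsub>?L\<^esub> (Y \<sqinter>\<^bsub>?L\<^esub> Z)"
    using cl by (simp add: W_def K_def five_point_meet)
qed

section \<open>The impossibility of an embedding\<close>

lemma five_point_not_embeddable:
  fixes M (structure)
  assumes M: "lattice M" "weak_partial_order_bottom M" "noetherian M" "atomistic M"
      "biatomic M" "join_semidistributive M"
  shows "\<not> lattice_embedding five_point_lattice M f"
proof
  let ?L = five_point_lattice
  assume f: "lattice_embedding ?L M f"
  interpret lattice M by fact
  have fM: "f \<in> carrier ?L \<rightarrow> carrier M" and inj: "inj_on f (carrier ?L)"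
    and jp: "join_pres ?L M f" and mp: "meet_pres ?L M f"
    using f by (auto simp: lattice_embedding_def)
  have closed: "f X \<in> carrier M" if "rel_convex X" for X
    using fM that by auto
  have f_meet: "f X \<sqinter> f Y = f (X \<inter> Y)" if "rel_convex X" "rel_convex Y" for X Y
    using mp that by (simp add: meet_pres_def five_point_meet)
  have f_le: "f X \<sqsubseteq> f Y" if "rel_convex X" "rel_convex Y" "X \<subseteq> Y" for X Y
    using f_meet[of X Y] meet_right[of "f X" "f Y"] that closed by (simp add: Int_absorb2)
  have f_le_join: "f Z \<sqsubseteq> f X \<squnion> f Y"
    if "rel_convex X" "rel_convex Y" "rel_convex Z"
      "\<And>T. rel_convex T \<Longrightarrow> X \<union> Y \<subseteq> T \<Longrightarrow> Z \<subseteq> T" for X Y Z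
  proof -
    let ?J = "X \<squnion>\<^bsub>?L\<^esub> Y"
    have J: "rel_convex ?J" "X \<subseteq> ?J" "Y \<subseteq> ?J"
      using that five_point.join_closed[of X Y] five_point.join_left[of X Y]
        five_point.join_right[of X Y] by simp_all
    then have "f Z \<sqsubseteq> f ?J" using that by (intro f_le) auto
    then show ?thesis using jp that by (simp add: join_pres_def)
  qed
  have join_f_le: "f X \<squnion> f Y \<sqsubseteq> f Z" if "rel_convex X" "rel_convex Y" "rel_convex Z" "X \<union> Y \<subseteq> Z"
    for X Y Z
    using that closed f_le by (intro join_le) auto
  have meet_join_le: "f Z \<sqinter> (f X \<squnion> f Y) \<sqsubseteq> f Y"
    if "rel_convex X" "rel_convex Y" "rel_convex Z" "rel_convex T" "X \<union> Y \<subseteq> T" "Z \<inter> T = Y"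
    for X Y Z T
  proof -
    have "f Z \<sqinter> (f X \<squnion> f Y) \<sqsubseteq> f Z \<sqinter> f T"
      using that closed join_f_le[of X Y T] meet_left[of "f Z" "f X \<squnion> f Y"]
        meet_right[of "f Z" "f X \<squnion> f Y"] le_trans[of "f Z \<sqinter> (f X \<squnion> f Y)" "f X \<squnion> f Y" "f T"]
      by (intro meet_le) auto
    then show ?thesis using f_meet that by simp
  qed
  have rc: "rel_convex {}" "rel_convex {pt_a}" "rel_convex {pt_b}" "rel_convex {pt_c}" "rel_convex {pt_p}"
    "rel_convex {pt_a, pt_b}" "rel_convex {pt_c, pt_b}" "rel_convex {pt_a, pt_c}"
    "rel_convex {pt_b, pt_p}" "rel_convex {pt_b, pt_r}"
    by (auto simp: rel_convex_def)
  have "\<not> f {pt_p} \<sqsubseteq> f {}"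
  proof
    assume "f {pt_p} \<sqsubseteq> f {}"
    then have "f {pt_p} = f {}"
      by (rule le_antisym) (use f_le[of "{}" "{pt_p}"] closed rc in auto)
    then have "{pt_p} = {}"
      by (rule inj_onD[OF inj]) (use rc in auto)
    then show False by simp
  qed
  then obtain p where p: "is_atom M p" "p \<sqsubseteq> f {pt_p}" "\<not> p \<sqsubseteq> f {}"
    using atomistic_atom_not_below[OF M(1,4) closed[OF rc(5)] closed[OF rc(1)]] by blast
  have pM: "p \<in> carrier M" using p by (simp add: is_atom_def)
  have "p \<sqsubseteq> f {pt_b, pt_p}"
    by (rule le_trans[OF p(2) f_le]) (use pM closed rc in auto)
  moreover have "f {pt_b, pt_p} \<sqsubseteq> f {pt_a} \<squnion> f {pt_b, pt_r}"
    by (rule f_le_join) (use rc in \<open>auto simp: rel_convex_def\<close>)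
  moreover have "f {pt_b, pt_r} \<sqsubseteq> f {pt_c} \<squnion> f {pt_b, pt_p}"
    by (rule f_le_join) (use rc in \<open>auto simp: rel_convex_def\<close>)
  moreover have "f {pt_b, pt_p} \<sqinter> (f {pt_a} \<squnion> f {pt_b}) \<sqsubseteq> f {pt_b}"
    by (rule meet_join_le[where T = "{pt_a, pt_b}"]) (use rc in auto)
  moreover have "f {pt_b, pt_r} \<sqinter> (f {pt_c} \<squnion> f {pt_b}) \<sqsubseteq> f {pt_b}"
    by (rule meet_join_le[where T = "{pt_c, pt_b}"]) (use rc in auto)
  moreover have "f {pt_b, pt_p} \<sqinter> f {pt_b, pt_r} \<sqsubseteq> f {pt_b}"
    using f_meet[of "{pt_b, pt_p}" "{pt_b, pt_r}"] rc closed by simp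
  ultimately have "p \<sqsubseteq> f {pt_b} \<or> p \<sqsubseteq> f {pt_a, pt_c}"
    using biatomic_zigzag[OF M(1,2,3,5,6), of "f {pt_a}" "f {pt_b}" "f {pt_c}"
        "f {pt_b, pt_p}" "f {pt_b, pt_r}" "f {pt_a, pt_c}" p] closed rc f_le p(1) by simp
  moreover have "p \<sqsubseteq> f {}" if "p \<sqsubseteq> f S" "rel_convex S" "pt_p \<notin> S" for S
    using meet_le[OF p(2) that(1)] f_meet[of "{pt_p}" S] that rc pM closed by simp
  ultimately show False using p(3) rc by auto
qed

theorem corollary7p5:
  shows "lattice five_point_lattice \<and>
    finite (carrier five_point_lattice) \<and>
    atomistic five_point_lattice \<and>
    join_semidistributive five_point_lattice \<and>
    (\<forall>M :: 'b gorder.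
       lattice M \<and> weak_partial_order_bottom M \<and> noetherian M \<and>
       atomistic M \<and> biatomic M \<and> join_semidistributive M \<longrightarrow>
       \<not> (\<exists>f. lattice_embedding five_point_lattice M f))"
proof -
  have "finite (carrier five_point_lattice)"
    by (rule finite_subset[of _ "Pow UNIV"]) (auto simp del: Pow_UNIV simp: finite_points)
  then show ?thesis
    using lattice_five_point atomistic_five_point join_semidistributive_five_point
      five_point_not_embeddable by blast
qed

end
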